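(* Let $\mathcal{H}$ be a non-trivial complex Hilbert space, let $A\neq 0$ be a positive operator on $\mathcal{H}$, and let $T\in \mathcal{B}_{A^{1/2}}(\mathcal{H})$. Then the following assertions are equivalent: (1) $T$ is $A$-spectraloid. (2) $\omega_A(T^n)=\omega_A(T)^n$ for all $n\in\mathbb{N}^*$.
   Context: $\mathcal{B}(\mathcal{H})$ is the algebra of bounded linear operators on $\mathcal{H}$; inner product $\langle\cdot\mid\cdot\rangle$. $A\in\mathcal{B}(\mathcal{H})$ is positive if $\langle Ax\mid x\rangle\ge 0$ for all $x\in\mathcal{H}$. Put $\langle x\mid y\rangle_A:=\langle Ax\mid y\rangle$ and $\|x\|_A:=\langle x\mid x\rangle_A^{1/2}$ (a seminorm). $\mathcal{B}_{A^{1/2}}(\mathcal{H})$ is the set of $A$-bounded operators: those $T\in\mathcal{B}(\mathcal{H})$ for which there is $\lambda>0$ with $\|Tx\|_A\le\lambda\|x\|_A$ for all $x\in\mathcal{H}$. For such $T$, $\|T\|_A:=\sup\{\|Tx\|_A/\|x\|_A : x\in\overline{\mathcal{R}(A)},\ x\neq 0\}$, where $\mathcal{R}(A)$ is the range of $A$ (closure in the norm of $\mathcal{H}$). The $A$-spectral radius of $T\in\mathcal{B}_{A^{1/2}}(\mathcal{H})$ is $r_A(T):=\inf_{n\in\mathbb{N}^*}\|T^n\|_A^{1/n}$, with $\mathbb{N}^*$ the set of positive integers. The $A$-numerical radius is $\omega_A(T):=\sup\{|\langle Tx\mid x\rangle_A| : x\in\mathcal{H},\ \|x\|_A=1\}$.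 An operator $T\in\mathcal{B}_{A^{1/2}}(\mathcal{H})$ is $A$-spectraloid if $r_A(T)=\omega_A(T)$. *)

theory Defs
  imports "HOL-Analysis.Analysis"
begin

text \<open>
  Complex inner product spaces; the form is linear in its first argument. The type is also a real
  normed vector space, whose scaling and norm are required to be the induced ones, so that the
  library's topology, closure and completeness are those of the inner product norm.
\<close>

class complex_inner = real_normed_vector +
  fixes scaleC :: "complex \<Rightarrow> 'a \<Rightarrow> 'a"  (infixr "*\<^sub>C" 75)
    and cinner :: "'a \<Rightarrow> 'a \<Rightarrow> complex"
  assumes scaleR_scaleC: "r *\<^sub>R x = complex_of_real r *\<^sub>C x"
    and scaleC_add_right: "a *\<^sub>C (x + y) = a *\<^sub>C x + a *\<^sub>C y"
    and scaleC_add_left: "(a + b) *\<^sub>C x = a *\<^sub>C x + b *\<^sub>C x"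
    and scaleC_scaleC: "a *\<^sub>C b *\<^sub>C x = (a * b) *\<^sub>C x"
    and scaleC_one: "1 *\<^sub>C x = x"
    and cinner_commute: "cinner x y = cnj (cinner y x)"
    and cinner_add_left: "cinner (x + y) z = cinner x z + cinner y z"
    and cinner_scaleC_left: "cinner (a *\<^sub>C x) y = a * cinner x y"
    and cinner_self_nonneg: "cinner x x \<in> \<real>\<^sub>\<ge>\<^sub>0"
    and cinner_eq_zero_iff: "cinner x x = 0 \<longleftrightarrow> x = 0"
    and norm_eq_sqrt_cinner: "norm x = sqrt (Re (cinner x x))"

class chilbert_space = complex_inner + complete_space

instantiation complex :: chilbert_space
begin

definition scaleC_complex :: "complex \<Rightarrow> complex \<Rightarrow> complex" where
  "scaleC_complex a x = a * x"

definition cinner_complex :: "complex \<Rightarrow> complex \<Rightarrow> complex" where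
  "cinner_complex x y = x * cnj y"

instance
proof
  fix x :: complex
  show "cinner x x \<in> \<real>\<^sub>\<ge>\<^sub>0"
    by (simp add: cinner_complex_def complex_nonneg_Reals_iff)
  show "norm x = sqrt (Re (cinner x x))"
    by (simp add: cinner_complex_def cmod_def power2_eq_square)
qed (auto simp: scaleC_complex_def cinner_complex_def scaleR_conv_of_real algebra_simps)

end

definition bounded_clinear :: "('a::complex_inner \<Rightarrow> 'a) \<Rightarrow> bool" where
  "bounded_clinear T \<longleftrightarrow> bounded_linear T \<and> (\<forall>c x. T (c *\<^sub>C x) = c *\<^sub>C T x)"

definition positive_op :: "('a::complex_inner \<Rightarrow> 'a) \<Rightarrow> bool" where
  "positive_op A \<longleftrightarrow> bounded_clinear A \<and> (\<forall>x. cinner (A x) x \<in> \<real>\<^sub>\<ge>\<^sub>0)"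

definition A_inner :: "('a::complex_inner \<Rightarrow> 'a) \<Rightarrow> 'a \<Rightarrow> 'a \<Rightarrow> complex" where
  "A_inner A x y = cinner (A x) y"

text \<open>For positive \<open>A\<close> the number \<open>A_inner A x x\<close> is real, so \<open>Re\<close> loses nothing.\<close>

definition A_norm :: "('a::complex_inner \<Rightarrow> 'a) \<Rightarrow> 'a \<Rightarrow> real" where
  "A_norm A x = sqrt (Re (A_inner A x x))"

definition A_bounded :: "('a::complex_inner \<Rightarrow> 'a) \<Rightarrow> ('a \<Rightarrow> 'a) set" where
  "A_bounded A = {T. bounded_clinear T \<and> (\<exists>l>0. \<forall>x. A_norm A (T x) \<le> l * A_norm A x)}"

text \<open>
  The real suprema and the infimum below are meant for positive \<open>A \<noteq> 0\<close> and \<open>A\<close>-bounded \<open>T\<close>, where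
  they range over nonempty bounded sets; there, also, \<open>A_norm A x \<noteq> 0\<close> for every nonzero \<open>x\<close> in
  the closure of the range of \<open>A\<close>.
\<close>

definition A_opnorm :: "('a::complex_inner \<Rightarrow> 'a) \<Rightarrow> ('a \<Rightarrow> 'a) \<Rightarrow> real" where
  "A_opnorm A T = Sup {A_norm A (T x) / A_norm A x | x. x \<in> closure (range A) \<and> x \<noteq> 0}"

definition A_spectral_radius :: "('a::complex_inner \<Rightarrow> 'a) \<Rightarrow> ('a \<Rightarrow> 'a) \<Rightarrow> real" where
  "A_spectral_radius A T = (INF n\<in>{1::nat..}. root n (A_opnorm A (T ^^ n)))"

definition A_numerical_radius :: "('a::complex_inner \<Rightarrow> 'a) \<Rightarrow> ('a \<Rightarrow> 'a) \<Rightarrow> real" where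
  "A_numerical_radius A T = Sup {cmod (A_inner A (T x) x) | x. A_norm A x = 1}"

definition A_spectraloid :: "('a::complex_inner \<Rightarrow> 'a) \<Rightarrow> ('a \<Rightarrow> 'a) \<Rightarrow> bool" where
  "A_spectraloid A T \<longleftrightarrow> T \<in> A_bounded A \<and> A_spectral_radius A T = A_numerical_radius A T"

end

theory Submission
  imports Defs
begin

text \<open>
  Write \<open>\<omega>\<close>, \<open>r\<close> and \<open>N\<close> for the \<open>A\<close>-numerical radius, \<open>A\<close>-spectral radius and \<open>A\<close>-operator
  seminorm. Cauchy-Schwarz and polarization give \<open>\<omega> \<le> N \<le> 2 \<omega>\<close>; Pearcy's proof of the power inequality
  \<open>\<omega>(T\<^sup>n) \<le> \<omega>(T)\<^sup>n\<close> uses only the semi-inner product, so no \<open>A\<close>-adjoint is needed. Hence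
  \<open>N(T\<^sup>n) \<le> 2 \<omega>(T)\<^sup>n\<close>, so \<open>r \<le> \<omega>\<close>. If \<open>r(T) = \<omega>(T)\<close>, then
  \<open>\<omega>(T)\<^sup>n = r(T)\<^sup>n \<le> r(T\<^sup>n) \<le> \<omega>(T\<^sup>n)\<close>; conversely, \<open>\<omega>(T)\<^sup>n = \<omega>(T\<^sup>n) \<le> N(T\<^sup>n)\<close> for all \<open>n\<close>
  gives \<open>\<omega>(T) \<le> r(T)\<close>. Since \<open>N\<close> is a supremum over the closure of the range of \<open>A\<close> only,
  \<open>\<omega> \<le> N\<close> also needs that this range is dense for the \<open>A\<close>-seminorm.
\<close>

section \<open>Algebra of complex inner product spaces and of operators on them\<close>

lemma cinner_add_right: "cinner x (y + z) = cinner x y + cinner x (z::'a::complex_inner)"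
  by (metis cinner_commute cinner_add_left complex_cnj_add)

lemma cinner_scaleC_right: "cinner x (a *\<^sub>C y) = cnj a * cinner x (y::'a::complex_inner)"
  by (metis cinner_commute cinner_scaleC_left complex_cnj_mult)

lemma scaleC_zero_left [simp]: "0 *\<^sub>C x = (0::'a::complex_inner)"
  by (metis of_real_0 scaleR_scaleC scale_zero_left)

lemma scaleC_minus_one: "(-1) *\<^sub>C x = - (x::'a::complex_inner)"
  by (metis of_real_1 of_real_minus scaleR_scaleC scaleR_minus1_left)

lemma scaleC_sum_left: "(\<Sum>i\<in>I. f i) *\<^sub>C x = (\<Sum>i\<in>I. f i *\<^sub>C (x::'a::complex_inner))"
  by (induction I rule: infinite_finite_induct) (auto simp: scaleC_add_left)

lemma scaleC_sum_right: "a *\<^sub>C (\<Sum>i\<in>I. f i) = (\<Sum>i\<in>I. a *\<^sub>C (f i::'a::complex_inner))"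
proof -
  have "a *\<^sub>C (0::'a) = 0"
    by (metis scaleC_scaleC mult_zero_right scaleC_zero_left)
  then show ?thesis
    by (induction I rule: infinite_finite_induct) (auto simp: scaleC_add_right)
qed

lemma bounded_clinear_linear: "bounded_clinear T \<Longrightarrow> linear T"
  by (simp add: bounded_clinear_def bounded_linear.linear)

lemma bounded_clinear_scaleC: "bounded_clinear T \<Longrightarrow> T (c *\<^sub>C x) = c *\<^sub>C T x"
  by (simp add: bounded_clinear_def)

lemma bounded_clinear_compose:
  "bounded_clinear S \<Longrightarrow> bounded_clinear T \<Longrightarrow> bounded_clinear (S \<circ> T)"
  by (auto simp: bounded_clinear_def o_def intro: bounded_linear_compose)

lemma bounded_clinear_id: "bounded_clinear id"
  by (auto simp: bounded_clinear_def id_def)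

lemma A_bounded_funpow:
  assumes "T \<in> A_bounded A"
  shows "T ^^ n \<in> A_bounded A"
proof (induction n)
  case 0
  then show ?case
    using bounded_clinear_id by (auto simp: A_bounded_def id_def intro!: exI[of _ 1])
next
  case (Suc n)
  from assms obtain l where l: "l > 0" "\<And>x. A_norm A (T x) \<le> l * A_norm A x"
    by (auto simp: A_bounded_def)
  from Suc obtain k where k: "k > 0" "\<And>x. A_norm A ((T ^^ n) x) \<le> k * A_norm A x"
    by (auto simp: A_bounded_def)
  have "A_norm A ((T ^^ Suc n) x) \<le> (l * k) * A_norm A x" for x
    using l(2)[of "(T ^^ n) x"] mult_left_mono[OF k(2)[of x], of l] l(1)
    by (auto simp only: mult.assoc funpow.simps o_apply intro: order_trans less_imp_le)
  moreover have "l * k > 0"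
    using l k by simp
  moreover have "bounded_clinear (T ^^ Suc n)"
    using assms Suc by (auto simp: A_bounded_def intro: bounded_clinear_compose)
  ultimately show ?case
    unfolding A_bounded_def by blast
qed

section \<open>The semi-inner product defined by a positive operator\<close>

locale positive_operator =
  fixes A :: "'a::complex_inner \<Rightarrow> 'a"
  assumes positive: "positive_op A"
begin

lemma clinear: "bounded_clinear A"
  using positive by (simp add: positive_op_def)

lemma A_inner_add_left: "A_inner A (x + y) z = A_inner A x z + A_inner A y z"
  by (simp add: A_inner_def linear_add[OF bounded_clinear_linear[OF clinear]] cinner_add_left)

lemma A_inner_add_right: "A_inner A z (x + y) = A_inner A z x + A_inner A z y"
  by (simp add: A_inner_def cinner_add_right)

lemma A_inner_scaleC_left: "A_inner A (c *\<^sub>C x) y = c * A_inner A x y"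
  by (simp add: A_inner_def bounded_clinear_scaleC[OF clinear] cinner_scaleC_left)

lemma A_inner_scaleC_right: "A_inner A x (c *\<^sub>C y) = cnj c * A_inner A x y"
  by (simp add: A_inner_def cinner_scaleC_right)

lemma A_inner_minus_left: "A_inner A (- x) y = - A_inner A x y"
  using A_inner_scaleC_left[of "-1"] by (simp add: scaleC_minus_one)

lemma A_inner_minus_right: "A_inner A x (- y) = - A_inner A x y"
  using A_inner_scaleC_right[of _ "-1"] by (simp add: scaleC_minus_one)

lemma A_inner_diff_left: "A_inner A (x - y) z = A_inner A x z - A_inner A y z"
  using A_inner_add_left[of x "- y"] by (simp add: A_inner_minus_left)

lemma A_inner_diff_right: "A_inner A z (x - y) = A_inner A z x - A_inner A z y"
  using A_inner_add_right[of _ x "- y"] by (simp add: A_inner_minus_right)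

lemma A_inner_sum_right: "A_inner A x (\<Sum>i\<in>I. f i) = (\<Sum>i\<in>I. A_inner A x (f i))"
proof -
  have "A_inner A x 0 = 0"
    using A_inner_diff_right[of x 0 0] by simp
  then show ?thesis
    by (induction I rule: infinite_finite_induct) (auto simp: A_inner_add_right)
qed

lemmas A_inner_simps = A_inner_add_left A_inner_add_right A_inner_diff_left A_inner_diff_right
  A_inner_scaleC_left A_inner_scaleC_right

lemma A_inner_self_nonneg: "A_inner A x x \<in> \<real>\<^sub>\<ge>\<^sub>0"
  using positive by (simp add: positive_op_def A_inner_def)

text \<open>The form is real on the diagonal by positivity. Evaluating it at \<open>x + y\<close>
  compares the imaginary parts, and at \<open>x + \<i> *\<^sub>C y\<close> the real parts.\<close>

lemma A_inner_commute: "A_inner A x y = cnj (A_inner A y x)"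
proof -
  have real: "Im (A_inner A z z) = 0" for z
    using A_inner_self_nonneg[of z] by (simp add: complex_nonneg_Reals_iff)
  have "Im (A_inner A x y) + Im (A_inner A y x) = 0"
    using real[of "x + y"] real[of x] real[of y] by (simp add: A_inner_simps)
  moreover have "Re (A_inner A x y) = Re (A_inner A y x)"
    using real[of "x + \<i> *\<^sub>C y"] real[of x] real[of y] by (simp add: A_inner_simps)
  ultimately show ?thesis
    by (simp add: complex_eq_iff)
qed

lemma A_norm_nonneg [simp]: "A_norm A x \<ge> 0"
  using A_inner_self_nonneg[of x] by (simp add: A_norm_def complex_nonneg_Reals_iff)

lemma A_inner_self: "A_inner A x x = of_real ((A_norm A x)\<^sup>2)"
  using A_inner_self_nonneg[of x]
  by (simp add: A_norm_def complex_nonneg_Reals_iff complex_eq_iff)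

lemma A_norm_scaleC: "A_norm A (c *\<^sub>C x) = cmod c * A_norm A x"
proof -
  have "A_inner A (c *\<^sub>C x) (c *\<^sub>C x) = (c * cnj c) * A_inner A x x"
    unfolding A_inner_scaleC_left A_inner_scaleC_right by (simp add: mult_ac)
  also have "\<dots> = of_real ((cmod c * A_norm A x)\<^sup>2)"
    unfolding A_inner_self complex_norm_square[symmetric] by (simp add: power_mult_distrib)
  finally have "(A_norm A (c *\<^sub>C x))\<^sup>2 = (cmod c * A_norm A x)\<^sup>2"
    unfolding A_inner_self of_real_eq_iff .
  then show ?thesis
    by (simp add: power2_eq_iff_nonneg)
qed

lemma A_norm_add_sq: "(A_norm A (x + y))\<^sup>2 = (A_norm A x)\<^sup>2 + (A_norm A y)\<^sup>2 + 2 * Re (A_inner A x y)"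
proof -
  have "Re (A_inner A (x + y) (x + y)) = (A_norm A x)\<^sup>2 + (A_norm A y)\<^sup>2 + 2 * Re (A_inner A x y)"
    using arg_cong[OF A_inner_commute[of y x], of Re]
    unfolding A_inner_add_left A_inner_add_right by (simp add: A_inner_self)
  then show ?thesis
    unfolding A_inner_self Re_complex_of_real .
qed

lemma A_norm_minus: "A_norm A (- x) = A_norm A x"
  using A_norm_scaleC[of "-1" x] by (simp add: scaleC_minus_one)

lemma A_norm_diff_sq: "(A_norm A (x - y))\<^sup>2 = (A_norm A x)\<^sup>2 + (A_norm A y)\<^sup>2 - 2 * Re (A_inner A x y)"
  using A_norm_add_sq[of x "- y"] by (simp add: A_norm_minus A_inner_minus_right)

lemma A_norm_parallelogram:
  "(A_norm A (x + y))\<^sup>2 + (A_norm A (x - y))\<^sup>2 = 2 * (A_norm A x)\<^sup>2 + 2 * (A_norm A y)\<^sup>2"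
  by (simp add: A_norm_add_sq A_norm_diff_sq)

text \<open>The squared seminorm of \<open>x - (t * b) *\<^sub>C y\<close> is a nonnegative
  quadratic in the real variable \<open>t\<close>. As the seminorm may vanish at \<open>y\<close>,
  its leading coefficient can be 0, which is a case of its own.\<close>

lemma A_inner_Cauchy_Schwarz: "cmod (A_inner A x y) \<le> A_norm A x * A_norm A y"
proof -
  define b where "b = A_inner A x y"
  have le: "0 \<le> (A_norm A x)\<^sup>2 - 2 * t * (cmod b)\<^sup>2 + t\<^sup>2 * (cmod b)\<^sup>2 * (A_norm A y)\<^sup>2" for t
  proof -
    have "Re (A_inner A x ((of_real t * b) *\<^sub>C y)) = t * (cmod b)\<^sup>2"
      unfolding A_inner_scaleC_right b_def[symmetric] cmod_power2
      by (simp add: power2_eq_square algebra_simps)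
    then show ?thesis
      using zero_le_power2[of "A_norm A (x - (of_real t * b) *\<^sub>C y)"]
      by (simp add: A_norm_diff_sq A_norm_scaleC norm_mult power_mult_distrib)
  qed
  have "(cmod b)\<^sup>2 \<le> (A_norm A x * A_norm A y)\<^sup>2"
  proof (cases "A_norm A y = 0")
    case True
    have "b = 0"
    proof (rule ccontr)
      assume "b \<noteq> 0"
      then show False
        \<comment> \<open>The quadratic has become affine in \<open>t\<close>, and this
          \<open>t\<close> gives it the value -1.\<close>
        using le[of "((A_norm A x)\<^sup>2 + 1) / (2 * (cmod b)\<^sup>2)"] True by simp
    qed
    then show ?thesis by simp
  next
    case False
    then have y: "(A_norm A y)\<^sup>2 > 0" by simp
    have "0 \<le> (A_norm A x)\<^sup>2 - (cmod b)\<^sup>2 / (A_norm A y)\<^sup>2"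
      \<comment> \<open>This is the minimizer of the quadratic.\<close>
      using le[of "1 / (A_norm A y)\<^sup>2"] False by (simp add: power2_eq_square)
    then show ?thesis
      using y by (simp add: field_simps power_mult_distrib)
  qed
  then show ?thesis
    by (simp add: b_def power2_le_iff_abs_le)
qed

lemma A_norm_triangle: "A_norm A (x + y) \<le> A_norm A x + A_norm A y"
proof (rule power2_le_imp_le)
  have "Re (A_inner A x y) \<le> A_norm A x * A_norm A y"
    using A_inner_Cauchy_Schwarz complex_Re_le_cmod order_trans by blast
  then show "(A_norm A (x + y))\<^sup>2 \<le> (A_norm A x + A_norm A y)\<^sup>2"
    by (simp add: A_norm_add_sq power2_sum)
qed simp

end

text \<open>With the identity in place of \<open>A\<close>, the results on the semi-inner product
  specialize to the inner product itself.\<close>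

lemma positive_operator_ident: "positive_operator (\<lambda>x::'a::complex_inner. x)"
  using bounded_clinear_id unfolding id_def
  by unfold_locales (simp add: positive_op_def cinner_self_nonneg)

lemma A_norm_ident: "A_norm (\<lambda>x. x) = norm"
  by (simp add: fun_eq_iff A_norm_def A_inner_def norm_eq_sqrt_cinner)

lemma cinner_Cauchy_Schwarz: "cmod (cinner x y) \<le> norm x * norm (y::'a::complex_inner)"
  using positive_operator.A_inner_Cauchy_Schwarz[OF positive_operator_ident, of x y]
  by (simp add: A_norm_ident A_inner_def)

lemma cinner_self: "cinner x x = of_real ((norm (x::'a::complex_inner))\<^sup>2)"
  using positive_operator.A_inner_self[OF positive_operator_ident, of x]
  by (simp add: A_norm_ident A_inner_def)

lemma norm_diff_sq:
  "(norm (x - y))\<^sup>2 = (norm x)\<^sup>2 + (norm y)\<^sup>2 - 2 * Re (cinner x (y::'a::complex_inner))"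
  using positive_operator.A_norm_diff_sq[OF positive_operator_ident, of x y]
  by (simp add: A_norm_ident A_inner_def)

section \<open>Density of the range of \<open>A\<close> in the seminorm\<close>

context positive_operator
begin

lemma A_norm_apply_le:
  assumes M: "M \<ge> 0" "\<And>x. norm (A x) \<le> M * norm x"
  shows "(A_norm A (A x))\<^sup>2 \<le> M * (norm (A x))\<^sup>2"
proof -
  have "(A_norm A (A x))\<^sup>2 = cmod (cinner (A (A x)) (A x))"
    using A_inner_self[of "A x"] by (simp add: A_inner_def norm_power)
  also have "\<dots> \<le> norm (A (A x)) * norm (A x)"
    by (rule cinner_Cauchy_Schwarz)
  also have "\<dots> \<le> (M * norm (A x)) * norm (A x)"
    by (intro mult_right_mono M) simp
  finally show ?thesis
    by (simp add: power2_eq_square mult.assoc)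
qed

text \<open>This is the operator inequality \<open>A\<close> squared \<le> \<open>M\<close> times
  \<open>A\<close>, obtained without a square root of \<open>A\<close>: Cauchy-Schwarz for the
  semi-inner product of \<open>x\<close> and \<open>A x\<close>, followed by cancelling the squared
  norm of \<open>A x\<close>. It also shows that the seminorm vanishes only on the kernel of
  \<open>A\<close>.\<close>

lemma norm_apply_le_A_norm:
  assumes M: "M \<ge> 0" "\<And>x. norm (A x) \<le> M * norm x"
  shows "(norm (A x))\<^sup>2 \<le> M * (A_norm A x)\<^sup>2"
proof (cases "A x = 0")
  case False
  have "(norm (A x))\<^sup>2 = cmod (A_inner A x (A x))"
    by (simp add: A_inner_def cinner_self norm_power)
  also have "\<dots> \<le> A_norm A x * A_norm A (A x)"
    by (rule A_inner_Cauchy_Schwarz)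
  finally have "((norm (A x))\<^sup>2)\<^sup>2 \<le> (A_norm A x * A_norm A (A x))\<^sup>2"
    by (intro power_mono) auto
  also have "\<dots> \<le> (A_norm A x)\<^sup>2 * (M * (norm (A x))\<^sup>2)"
    unfolding power_mult_distrib by (intro mult_left_mono A_norm_apply_le M) simp
  finally have "(norm (A x))\<^sup>2 * (norm (A x))\<^sup>2 \<le> (M * (A_norm A x)\<^sup>2) * (norm (A x))\<^sup>2"
    by (simp only: power2_eq_square mult_ac)
  moreover have "(norm (A x))\<^sup>2 > 0"
    using False by simp
  ultimately show ?thesis
    by (simp only: mult_le_cancel_right_pos)
qed (use M in simp)

text \<open>
  Gradient descent with step \<open>1 / M\<close> for the quadratic form of \<open>A\<close>: the iterates differ from \<open>x\<close> by
  elements of the range, and their seminorms tend to 0.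
\<close>

lemma range_A_dense:
  assumes "e > 0"
  obtains y where "A_norm A (x - A y) < e"
proof -
  obtain M where M: "M > 0" "\<And>x. norm (A x) \<le> M * norm x"
    using bounded_linear.pos_bounded[of A] clinear by (auto simp: bounded_clinear_def mult.commute)
  have lin: "linear A"
    by (rule bounded_clinear_linear[OF clinear])
  define z where "z = rec_nat x (\<lambda>_ w. w - of_real (1 / M) *\<^sub>C A w)"
  have z_0: "z 0 = x" and z_Suc: "z (Suc k) = z k - of_real (1 / M) *\<^sub>C A (z k)" for k
    by (simp_all add: z_def)
  have range: "\<exists>y. z k = x - A y" for k
  proof (induction k)
    case 0
    show ?case
      using z_0 linear_0[OF lin] by (intro exI[of _ 0]) simp
  next
    case (Suc k)
    then obtain y where "z k = x - A y" by blast
    then have "z (Suc k) = x - A (y + of_real (1 / M) *\<^sub>C z k)"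
      by (simp add: z_Suc linear_add[OF lin] bounded_clinear_scaleC[OF clinear])
    then show ?case by blast
  qed
  \<comment> \<open>The first-order gain \<open>2 / M\<close> times the squared norm of
    \<open>A (z k)\<close> is at least twice the second-order loss, by
    \<open>A_norm_apply_le\<close>.\<close>
  have A_step: "(norm (A (z k)))\<^sup>2 \<le> M * ((A_norm A (z k))\<^sup>2 - (A_norm A (z (Suc k)))\<^sup>2)" for k
  proof -
    have "Re (A_inner A (z k) (of_real (1 / M) *\<^sub>C A (z k))) = (norm (A (z k)))\<^sup>2 / M"
      unfolding A_inner_scaleC_right by (simp add: A_inner_def cinner_self)
    then have "(A_norm A (z (Suc k)))\<^sup>2
        = (A_norm A (z k))\<^sup>2 + (A_norm A (A (z k)))\<^sup>2 / M\<^sup>2 - 2 * ((norm (A (z k)))\<^sup>2 / M)"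
      using M(1) by (simp add: z_Suc A_norm_diff_sq A_norm_scaleC norm_divide power_divide)
    moreover have "(A_norm A (A (z k)))\<^sup>2 / M\<^sup>2 \<le> (norm (A (z k)))\<^sup>2 / M"
      using A_norm_apply_le[of M "z k"] M by (simp add: field_simps power2_eq_square)
    ultimately have "(norm (A (z k)))\<^sup>2 / M \<le> (A_norm A (z k))\<^sup>2 - (A_norm A (z (Suc k)))\<^sup>2"
      by linarith
    then show ?thesis
      using M(1) by (simp add: field_simps)
  qed
  \<comment> \<open>The same step does not increase the Hilbert norm either, now by
    \<open>norm_apply_le_A_norm\<close>; this keeps the iterates bounded by
    \<open>norm x\<close>.\<close>
  have norm_step: "norm (z (Suc k)) \<le> norm (z k)" for k
  proof (rule power2_le_imp_le)
    have "cinner (z k) (A (z k)) = of_real ((A_norm A (z k))\<^sup>2)"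
      by (metis A_inner_def A_inner_self cinner_commute complex_cnj_complex_of_real)
    then have "Re (cinner (z k) (of_real (1 / M) *\<^sub>C A (z k))) = (A_norm A (z k))\<^sup>2 / M"
      unfolding cinner_scaleC_right by simp
    then have "(norm (z (Suc k)))\<^sup>2
        = (norm (z k))\<^sup>2 + (norm (A (z k)))\<^sup>2 / M\<^sup>2 - 2 * ((A_norm A (z k))\<^sup>2 / M)"
      using M(1) by (simp only: z_Suc norm_diff_sq scaleR_scaleC[symmetric] norm_scaleR)
        (simp add: power_divide)
    moreover have "(norm (A (z k)))\<^sup>2 / M\<^sup>2 \<le> (A_norm A (z k))\<^sup>2 / M"
      using norm_apply_le_A_norm[of M "z k"] M by (simp add: field_simps power2_eq_square)
    moreover have "(A_norm A (z k))\<^sup>2 / M \<ge> 0"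
      using M(1) by simp
    ultimately show "(norm (z (Suc k)))\<^sup>2 \<le> (norm (z k))\<^sup>2"
      by linarith
  qed simp
  then have norm_le: "norm (z k) \<le> norm x" for k
    by (induction k) (use z_0 order_trans in auto)
  have A_decr: "(A_norm A (z (Suc k)))\<^sup>2 \<le> (A_norm A (z k))\<^sup>2" for k
  proof -
    have "0 \<le> M * ((A_norm A (z k))\<^sup>2 - (A_norm A (z (Suc k)))\<^sup>2)"
      using A_step[of k] by (rule order_trans[rotated]) simp
    then show ?thesis
      using M(1) by (simp add: zero_le_mult_iff)
  qed
  have "convergent (\<lambda>k. (A_norm A (z k))\<^sup>2)"
  proof -
    have "decseq (\<lambda>k. (A_norm A (z k))\<^sup>2)"
      using A_decr by (simp add: decseq_Suc_iff)
    then obtain L where "(\<lambda>k. (A_norm A (z k))\<^sup>2) \<longlonglongrightarrow> L"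
      by (rule decseq_convergent[where B = 0]) auto
    then show ?thesis
      by (auto simp: convergent_def)
  qed
  then obtain L where L: "(\<lambda>k. (A_norm A (z k))\<^sup>2) \<longlonglongrightarrow> L"
    by (auto simp: convergent_def)
  \<comment> \<open>Consecutive terms of a convergent sequence have differences tending to 0,
    whatever the limit \<open>L\<close>.\<close>
  have "(\<lambda>k. M * ((A_norm A (z k))\<^sup>2 - (A_norm A (z (Suc k)))\<^sup>2) * (norm x)\<^sup>2)
      \<longlonglongrightarrow> M * (L - L) * (norm x)\<^sup>2"
    by (intro tendsto_intros L LIMSEQ_Suc[OF L])
  then have lim: "(\<lambda>k. M * ((A_norm A (z k))\<^sup>2 - (A_norm A (z (Suc k)))\<^sup>2) * (norm x)\<^sup>2)
      \<longlonglongrightarrow> 0"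
    by simp
  \<comment> \<open>The squared seminorm is the inner product of \<open>A (z k)\<close> with
    \<open>z k\<close>. Its second factor is bounded in norm, and its first is controlled by the
    decrease in \<open>A_step\<close>.\<close>
  have bound: "A_norm A (z k) ^ 4 \<le> M * ((A_norm A (z k))\<^sup>2 - (A_norm A (z (Suc k)))\<^sup>2) * (norm x)\<^sup>2"
    for k
  proof -
    have "(A_norm A (z k))\<^sup>2 = cmod (cinner (A (z k)) (z k))"
      using A_inner_self[of "z k"] by (simp add: A_inner_def norm_power)
    also have "\<dots> \<le> norm (A (z k)) * norm (z k)"
      by (rule cinner_Cauchy_Schwarz)
    also have "\<dots> \<le> norm (A (z k)) * norm x"
      by (intro mult_left_mono norm_le) simp
    finally have "((A_norm A (z k))\<^sup>2)\<^sup>2 \<le> (norm (A (z k)))\<^sup>2 * (norm x)\<^sup>2"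
      unfolding power_mult_distrib[symmetric] by (intro power_mono) auto
    also have "\<dots> \<le> M * ((A_norm A (z k))\<^sup>2 - (A_norm A (z (Suc k)))\<^sup>2) * (norm x)\<^sup>2"
      by (intro mult_right_mono A_step) simp
    finally show ?thesis by simp
  qed
  have "e ^ 4 > 0"
    using assms by simp
  from order_tendstoD(2)[OF lim this] obtain k where
    "M * ((A_norm A (z k))\<^sup>2 - (A_norm A (z (Suc k)))\<^sup>2) * (norm x)\<^sup>2 < e ^ 4"
    by (auto simp: eventually_sequentially)
  with bound[of k] have "A_norm A (z k) ^ 4 < e ^ 4"
    by linarith
  then have "A_norm A (z k) < e"
    using assms by (meson less_imp_le power_less_imp_less_base)
  with range[of k] that show ?thesis by metis
qed

section \<open>Suprema: the operator seminorm and the numerical radius\<close>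

text \<open>Makes the set in the definition of the numerical radius nonempty. A vector outside the
  kernel has nonzero seminorm by \<open>norm_apply_le_A_norm\<close> and can be normalized.\<close>

lemma A_norm_eq_1_exists:
  assumes "A \<noteq> (\<lambda>x. 0)"
  obtains x where "A_norm A x = 1"
proof -
  obtain w where w: "A w \<noteq> 0"
    using assms by auto
  obtain M where M: "M > 0" "\<And>x. norm (A x) \<le> M * norm x"
    using bounded_linear.pos_bounded[of A] clinear by (auto simp: bounded_clinear_def mult.commute)
  have "A_norm A w \<noteq> 0"
    using norm_apply_le_A_norm[of M w] M w by auto
  then have "A_norm A (of_real (1 / A_norm A w) *\<^sub>C w) = 1"
    unfolding A_norm_scaleC norm_of_real by simp
  with that show ?thesis .
qed

text \<open>On the range of \<open>A\<close> this is the definition of the supremum. Both sides are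
  continuous for the seminorm, so \<open>range_A_dense\<close> carries the bound over to every
  \<open>x\<close>.\<close>

lemma A_norm_le_A_opnorm:
  assumes "T \<in> A_bounded A"
  shows "A_norm A (T x) \<le> A_opnorm A T * A_norm A x"
proof -
  let ?S = "{A_norm A (T x) / A_norm A x | x. x \<in> closure (range A) \<and> x \<noteq> 0}"
  from assms obtain l where l: "l > 0" "\<And>x. A_norm A (T x) \<le> l * A_norm A x"
    and T: "bounded_clinear T"
    by (auto simp: A_bounded_def)
  \<comment> \<open>A quotient with denominator 0 has the value 0 and so also lies below
    \<open>l\<close>.\<close>
  have "bdd_above ?S"
    using l by (intro bdd_aboveI[of _ l]) (auto simp: divide_le_eq order_less_le)
  have range: "A_norm A (T (A y)) \<le> A_opnorm A T * A_norm A (A y)" for y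
  proof (cases "A_norm A (A y) = 0")
    case True
    then show ?thesis using l(2)[of "A y"] by simp
  next
    case False
    have "A_inner A 0 0 = 0"
      using A_inner_diff_left[of 0 0 0] by simp
    with False have "A y \<noteq> 0"
      by (auto simp: A_norm_def)
    moreover have "A y \<in> closure (range A)"
      by (rule subsetD[OF closure_subset rangeI])
    ultimately have "A_norm A (T (A y)) / A_norm A (A y) \<le> A_opnorm A T"
      unfolding A_opnorm_def by (intro cSup_upper \<open>bdd_above ?S\<close>) blast
    moreover have "A_norm A (A y) > 0"
      using False by (simp add: order_less_le)
    ultimately show ?thesis
      by (simp add: divide_le_eq)
  qed
  show ?thesis
  proof (rule field_le_epsilon)
    fix e :: real
    assume "e > 0"
    \<comment> \<open>Replacing \<open>x\<close> by \<open>A y\<close> costs at most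
      \<open>l\<close> times the seminorm of \<open>x - A y\<close> on the left and
      \<open>\<bar>A_opnorm A T\<bar>\<close> times it on the right. The absolute value appears
      because nonnegativity of \<open>A_opnorm\<close> is itself deduced from this lemma.\<close>
    define N where "N = \<bar>A_opnorm A T\<bar> + l"
    have "N > 0"
      using l(1) by (simp add: N_def)
    with \<open>e > 0\<close> obtain y where y: "A_norm A (x - A y) < e / N"
      using range_A_dense[of "e / N"] by auto
    have T_diff: "T x = T (A y) + T (x - A y)"
      by (simp add: linear_diff[OF bounded_clinear_linear[OF T]])
    have "\<bar>A_norm A (A y) - A_norm A x\<bar> \<le> A_norm A (x - A y)"
      using A_norm_triangle[of "A y" "x - A y"] A_norm_triangle[of x "- (x - A y)"]
      unfolding A_norm_minus by simp
    then have "\<bar>A_opnorm A T\<bar> * \<bar>A_norm A (A y) - A_norm A x\<bar> \<le> \<bar>A_opnorm A T\<bar> * A_norm A (x - A y)"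
      by (intro mult_left_mono) auto
    then have "A_opnorm A T * (A_norm A (A y) - A_norm A x) \<le> \<bar>A_opnorm A T\<bar> * A_norm A (x - A y)"
      unfolding abs_mult[symmetric] by linarith
    moreover have "A_norm A (T x) \<le> A_opnorm A T * A_norm A (A y) + l * A_norm A (x - A y)"
      using A_norm_triangle[of "T (A y)" "T (x - A y)"] range[of y] l(2)[of "x - A y"]
      by (simp add: T_diff[symmetric])
    moreover have "N * A_norm A (x - A y) \<le> e"
      using y \<open>N > 0\<close> by (simp add: field_simps)
    ultimately show "A_norm A (T x) \<le> A_opnorm A T * A_norm A x + e"
      by (simp add: N_def algebra_simps)
  qed
qed

lemma A_opnorm_le:
  assumes "A \<noteq> (\<lambda>x. 0)" "c \<ge> 0" "\<And>x. A_norm A (T x) \<le> c * A_norm A x"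
  shows "A_opnorm A T \<le> c"
  unfolding A_opnorm_def
proof (rule cSup_least)
  obtain w where "A w \<noteq> 0"
    using assms by auto
  moreover have "A w \<in> closure (range A)"
    by (rule subsetD[OF closure_subset rangeI])
  ultimately show "{A_norm A (T x) / A_norm A x | x. x \<in> closure (range A) \<and> x \<noteq> 0} \<noteq> {}"
    by blast
next
  fix r
  assume "r \<in> {A_norm A (T x) / A_norm A x | x. x \<in> closure (range A) \<and> x \<noteq> 0}"
  then obtain x where "r = A_norm A (T x) / A_norm A x"
    by blast
  then show "r \<le> c"
    using assms(2) assms(3)[of x] by (auto simp: divide_le_eq order_less_le)
qed

lemma A_opnorm_nonneg:
  assumes "A \<noteq> (\<lambda>x. 0)" "T \<in> A_bounded A"
  shows "A_opnorm A T \<ge> 0"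
proof -
  obtain x where "A_norm A x = 1"
    using A_norm_eq_1_exists[OF assms(1)] .
  then show ?thesis
    using order_trans[OF A_norm_nonneg A_norm_le_A_opnorm[OF assms(2), of x]] by simp
qed

lemma numerical_le:
  assumes "T \<in> A_bounded A"
  shows "cmod (A_inner A (T x) x) \<le> A_opnorm A T * (A_norm A x)\<^sup>2"
proof -
  have "cmod (A_inner A (T x) x) \<le> A_norm A (T x) * A_norm A x"
    by (rule A_inner_Cauchy_Schwarz)
  also have "\<dots> \<le> (A_opnorm A T * A_norm A x) * A_norm A x"
    by (intro mult_right_mono A_norm_le_A_opnorm assms) simp
  finally show ?thesis
    by (simp add: power2_eq_square mult.assoc)
qed

lemma A_numerical_radius_le:
  assumes "A \<noteq> (\<lambda>x. 0)" "\<And>x. cmod (A_inner A (T x) x) \<le> c * (A_norm A x)\<^sup>2"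
  shows "A_numerical_radius A T \<le> c"
  unfolding A_numerical_radius_def
proof (rule cSup_least)
  show "{cmod (A_inner A (T x) x) | x. A_norm A x = 1} \<noteq> {}"
    using A_norm_eq_1_exists[OF assms(1)] by blast
next
  fix r
  assume "r \<in> {cmod (A_inner A (T x) x) | x. A_norm A x = 1}"
  then obtain x where "r = cmod (A_inner A (T x) x)" "A_norm A x = 1"
    by blast
  then show "r \<le> c"
    using assms(2)[of x] by simp
qed

lemma A_numerical_radius_le_A_opnorm:
  assumes "A \<noteq> (\<lambda>x. 0)" "T \<in> A_bounded A"
  shows "A_numerical_radius A T \<le> A_opnorm A T"
  using A_numerical_radius_le[OF assms(1) numerical_le[OF assms(2)]] .

text \<open>Homogeneous form of the supremum: normalize \<open>x\<close> if its seminorm is nonzero;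
  otherwise the left side is 0 by Cauchy-Schwarz.\<close>

lemma le_A_numerical_radius:
  assumes "T \<in> A_bounded A"
  shows "cmod (A_inner A (T x) x) \<le> A_numerical_radius A T * (A_norm A x)\<^sup>2"
proof (cases "A_norm A x = 0")
  case True
  then show ?thesis
    using A_inner_Cauchy_Schwarz[of "T x" x] by simp
next
  case False
  define a where "a = complex_of_real (1 / A_norm A x)"
  have a: "cmod a = 1 / A_norm A x"
    by (simp add: a_def norm_divide)
  have bdd: "bdd_above {cmod (A_inner A (T x) x) | x. A_norm A x = 1}"
  proof (rule bdd_aboveI)
    fix r
    assume "r \<in> {cmod (A_inner A (T x) x) | x. A_norm A x = 1}"
    then obtain y where "r = cmod (A_inner A (T y) y)" "A_norm A y = 1"
      by blast
    then show "r \<le> A_opnorm A T"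
      using numerical_le[OF assms, of y] by simp
  qed
  have "A_norm A (a *\<^sub>C x) = 1"
    using False by (simp add: A_norm_scaleC a)
  then have "cmod (A_inner A (T (a *\<^sub>C x)) (a *\<^sub>C x)) \<le> A_numerical_radius A T"
    unfolding A_numerical_radius_def by (intro cSup_upper bdd) blast
  moreover have "T (a *\<^sub>C x) = a *\<^sub>C T x"
    using assms by (simp add: A_bounded_def bounded_clinear_scaleC)
  ultimately have "cmod (A_inner A (T x) x) / (A_norm A x)\<^sup>2 \<le> A_numerical_radius A T"
    by (simp add: A_inner_simps norm_mult a power2_eq_square)
  moreover have "(A_norm A x)\<^sup>2 > 0"
    using False by simp
  ultimately show ?thesis
    by (simp only: pos_divide_le_eq)
qed

lemma A_numerical_radius_nonneg:
  assumes "A \<noteq> (\<lambda>x. 0)" "T \<in> A_bounded A"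
  shows "A_numerical_radius A T \<ge> 0"
proof -
  obtain x where "A_norm A x = 1"
    using A_norm_eq_1_exists[OF assms(1)] .
  then show ?thesis
    using order_trans[OF norm_ge_zero le_A_numerical_radius[OF assms(2), of x]] by simp
qed

text \<open>Polarization bounds the sesquilinear form of \<open>T\<close> by its quadratic form;
  testing it against a multiple of \<open>T x\<close> then bounds \<open>T x\<close>.\<close>

lemma A_norm_le_of_numerical_le:
  assumes T: "bounded_clinear T" and "c > 0"
    and c: "\<And>x. cmod (A_inner A (T x) x) \<le> c * (A_norm A x)\<^sup>2"
  shows "A_norm A (T x) \<le> 2 * c * A_norm A x"
proof -
  have lin: "linear T"
    by (rule bounded_clinear_linear[OF T])
  define q where "q y = A_inner A (T y) y" for y
  have polar: "cmod (A_inner A (T x) y) \<le> c * ((A_norm A x)\<^sup>2 + (A_norm A y)\<^sup>2)" for y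
  proof -
    have "4 * A_inner A (T x) y = (q (x + y) - q (x - y)) + \<i> * (q (x + \<i> *\<^sub>C y) - q (x - \<i> *\<^sub>C y))"
      by (simp add: q_def linear_add[OF lin] linear_diff[OF lin] bounded_clinear_scaleC[OF T]
          A_inner_simps algebra_simps)
    then have "4 * cmod (A_inner A (T x) y)
        = cmod ((q (x + y) - q (x - y)) + \<i> * (q (x + \<i> *\<^sub>C y) - q (x - \<i> *\<^sub>C y)))"
      by (metis norm_mult norm_numeral)
    also have "\<dots> \<le> cmod (q (x + y) - q (x - y)) + cmod (q (x + \<i> *\<^sub>C y) - q (x - \<i> *\<^sub>C y))"
      by (rule norm_triangle_le) (simp add: norm_mult)
    also have "\<dots> \<le> (cmod (q (x + y)) + cmod (q (x - y)))
        + (cmod (q (x + \<i> *\<^sub>C y)) + cmod (q (x - \<i> *\<^sub>C y)))"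
      by (intro add_mono norm_triangle_ineq4)
    also have "\<dots> \<le> (c * (A_norm A (x + y))\<^sup>2 + c * (A_norm A (x - y))\<^sup>2)
        + (c * (A_norm A (x + \<i> *\<^sub>C y))\<^sup>2 + c * (A_norm A (x - \<i> *\<^sub>C y))\<^sup>2)"
      unfolding q_def by (intro add_mono c)
    \<comment> \<open>Two parallelogram identities, for \<open>y\<close> and for
      \<open>\<i> *\<^sub>C y\<close>, which have the same seminorm.\<close>
    also have "\<dots> = 4 * (c * ((A_norm A x)\<^sup>2 + (A_norm A y)\<^sup>2))"
      unfolding distrib_left[symmetric] A_norm_parallelogram by (simp add: A_norm_scaleC)
    finally show ?thesis by simp
  qed
  have "(A_norm A (T x))\<^sup>2 / (2 * c) \<le> c * ((A_norm A x)\<^sup>2 + (A_norm A (T x))\<^sup>2 / (4 * c\<^sup>2))"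
    \<comment> \<open>With the factor \<open>1 / (2 * c)\<close> the term in \<open>T x\<close> on
      the right is half of the left side and can be absorbed.\<close>
    using polar[of "of_real (1 / (2 * c)) *\<^sub>C T x"] \<open>c > 0\<close>
    unfolding A_inner_scaleC_right A_inner_self A_norm_scaleC
    by (simp add: norm_mult norm_divide norm_power power_mult_distrib power_divide)
  then have "(A_norm A (T x))\<^sup>2 \<le> (2 * c * A_norm A x)\<^sup>2"
    using \<open>c > 0\<close> by (simp add: field_simps power2_eq_square)
  then show ?thesis
    using \<open>c > 0\<close> by (auto intro: power2_le_imp_le[where y = "2 * c * A_norm A x"])
qed

lemma A_opnorm_le_A_numerical_radius:
  assumes "A \<noteq> (\<lambda>x. 0)" "T \<in> A_bounded A"
  shows "A_opnorm A T \<le> 2 * A_numerical_radius A T"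
proof (rule field_le_epsilon)
  fix e :: real
  assume "e > 0"
  \<comment> \<open>The margin \<open>e / 2\<close> makes \<open>c\<close> positive even if the
    numerical radius is 0.\<close>
  define c where "c = A_numerical_radius A T + e / 2"
  have "c > 0"
    using A_numerical_radius_nonneg[OF assms] \<open>e > 0\<close> by (simp add: c_def)
  have "cmod (A_inner A (T x) x) \<le> c * (A_norm A x)\<^sup>2" for x
  proof -
    have "A_numerical_radius A T * (A_norm A x)\<^sup>2 \<le> c * (A_norm A x)\<^sup>2"
      using \<open>e > 0\<close> by (intro mult_right_mono) (auto simp: c_def)
    then show ?thesis
      using le_A_numerical_radius[OF assms(2), of x] by linarith
  qed
  moreover have "bounded_clinear T"
    using assms by (simp add: A_bounded_def)
  ultimately have "A_norm A (T x) \<le> 2 * c * A_norm A x" for x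
    using A_norm_le_of_numerical_le \<open>c > 0\<close> by blast
  then have "A_opnorm A T \<le> 2 * c"
    using \<open>c > 0\<close> by (intro A_opnorm_le assms) auto
  then show "A_opnorm A T \<le> 2 * A_numerical_radius A T + e"
    by (simp add: c_def)
qed

end

section \<open>The power inequality for the numerical radius\<close>

text \<open>A geometric sum whose ratio \<open>w\<close> satisfies \<open>w ^ n = 1\<close>. For
  \<open>0 < m < n\<close> the ratio is not 1, since \<open>n\<close> does not divide
  \<open>m\<close>.\<close>

lemma sum_powers_root_of_unity:
  fixes n m :: nat
  assumes "m < n"
  shows "(\<Sum>j<n. cis (2 * pi / n) ^ (j * m)) = (if m = 0 then of_nat n else 0)"
proof (cases "m = 0")
  case False
  define w where "w = cis (2 * pi / n) ^ m"
  have "n > 0" using assms by simp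
  have w_eq: "w = cis (2 * pi * m / n)"
    by (simp add: w_def Complex.DeMoivre mult_ac)
  have "w ^ n = 1"
    using \<open>n > 0\<close> by (simp add: w_eq Complex.DeMoivre)
  moreover have "w \<noteq> 1"
  proof
    assume "w = 1"
    then have "cos (2 * pi * m / n) = 1"
      by (simp add: w_eq complex_eq_iff)
    then obtain k :: int where "2 * pi * m / n = of_int k * 2 * pi"
      by (auto simp: cos_one_2pi_int)
    then have "real m = of_int k * real n"
      using \<open>n > 0\<close> by (simp add: field_simps)
    then have "int m = k * int n"
      by (metis of_int_eq_iff of_int_mult of_int_of_nat_eq)
    then have "int n dvd int m" by simp
    then show False
      using assms False by (simp add: nat_dvd_not_less)
  qed
  ultimately have "(\<Sum>j<n. w ^ j) = 0"
    by (simp add: geometric_sum)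
  then show ?thesis
    using False by (simp add: w_def power_mult[symmetric] mult.commute)
qed simp

context positive_operator
begin

text \<open>
  Averaging over the \<open>n\<close>-th roots of unity \<open>w\<close>: the vectors
  \<open>x\<^sub>w = (\<Sum>m<n. (a w)\<^sup>m T\<^sup>m x)\<close> satisfy \<open>x\<^sub>w - a w T x\<^sub>w = x - a\<^sup>n T\<^sup>n x\<close> and sum to \<open>n x\<close>.
\<close>

lemma numerical_power_Re_le:
  fixes n :: nat
  assumes T: "bounded_clinear T" and "n > 0"
    and a: "\<And>y. cmod a * cmod (A_inner A (T y) y) \<le> (A_norm A y)\<^sup>2"
  shows "Re (a ^ n * A_inner A ((T ^^ n) x) x) \<le> (A_norm A x)\<^sup>2"
proof -
  define \<zeta> where "\<zeta> = cis (2 * pi / n)"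
  define b where "b j = a * \<zeta> ^ j" for j
  define X where "X j = (\<Sum>m<n. b j ^ m *\<^sub>C (T ^^ m) x)" for j
  have lin: "linear T"
    by (rule bounded_clinear_linear[OF T])
  have "\<zeta> ^ n = 1"
    using \<open>n > 0\<close> by (simp add: \<zeta>_def Complex.DeMoivre)
  then have b_n: "b j ^ n = a ^ n" for j
    by (simp add: b_def power_mult_distrib power_mult[symmetric])
       (metis mult.commute power_mult power_one)
  have telescope: "X j - b j *\<^sub>C T (X j) = x - a ^ n *\<^sub>C (T ^^ n) x" for j
  proof -
    have "b j *\<^sub>C T (X j) = (\<Sum>m<n. b j ^ Suc m *\<^sub>C (T ^^ Suc m) x)"
      by (simp add: X_def linear_sum[OF lin] bounded_clinear_scaleC[OF T] scaleC_sum_right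
          scaleC_scaleC)
    then have "X j - b j *\<^sub>C T (X j)
        = (\<Sum>m<n. b j ^ m *\<^sub>C (T ^^ m) x - b j ^ Suc m *\<^sub>C (T ^^ Suc m) x)"
      by (simp add: X_def sum_subtractf)
    also have "\<dots> = b j ^ 0 *\<^sub>C (T ^^ 0) x - b j ^ n *\<^sub>C (T ^^ n) x"
      by (rule sum_lessThan_telescope')
    finally show ?thesis
      by (simp add: b_n scaleC_one)
  qed
  \<comment> \<open>Averaging over the roots of unity kills every power of \<open>T\<close> except
    the zeroth.\<close>
  have sum_X: "(\<Sum>j<n. X j) = of_nat n *\<^sub>C x"
  proof -
    have "(\<Sum>j<n. X j) = (\<Sum>m<n. (\<Sum>j<n. b j ^ m) *\<^sub>C (T ^^ m) x)"
      unfolding X_def scaleC_sum_left by (rule sum.swap)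
    also have "\<dots> = (\<Sum>m<n. if m = 0 then of_nat n *\<^sub>C x else 0)"
    proof (rule sum.cong[OF refl])
      fix m
      assume "m \<in> {..<n}"
      then have "(\<Sum>j<n. b j ^ m) = a ^ m * (if m = 0 then of_nat n else 0)"
        by (simp add: b_def power_mult_distrib power_mult[symmetric] sum_distrib_left[symmetric]
            \<zeta>_def sum_powers_root_of_unity)
      then show "(\<Sum>j<n. b j ^ m) *\<^sub>C (T ^^ m) x = (if m = 0 then of_nat n *\<^sub>C x else 0)"
        by simp
    qed
    also have "\<dots> = of_nat n *\<^sub>C x"
      using \<open>n > 0\<close> by simp
    finally show ?thesis .
  qed
  \<comment> \<open>All \<open>b j\<close> have the modulus of \<open>a\<close>, so the hypothesis
    on \<open>a\<close> applies to each of them.\<close>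
  have nonneg: "0 \<le> Re (A_inner A (X j - b j *\<^sub>C T (X j)) (X j))" for j
  proof -
    have "Re (b j * A_inner A (T (X j)) (X j)) \<le> cmod (b j * A_inner A (T (X j)) (X j))"
      by (rule complex_Re_le_cmod)
    also have "\<dots> = cmod a * cmod (A_inner A (T (X j)) (X j))"
      by (simp add: b_def \<zeta>_def norm_mult norm_power)
    also have "\<dots> \<le> (A_norm A (X j))\<^sup>2"
      by (rule a)
    finally show ?thesis
      by (simp only: A_inner_diff_left A_inner_scaleC_left A_inner_self) simp
  qed
  have "0 \<le> (\<Sum>j<n. Re (A_inner A (X j - b j *\<^sub>C T (X j)) (X j)))"
    by (intro sum_nonneg nonneg)
  \<comment> \<open>By \<open>telescope\<close> the left argument is the same for all
    \<open>j\<close>, so the sum can be moved into the right argument.\<close>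
  also have "\<dots> = Re (A_inner A (x - a ^ n *\<^sub>C (T ^^ n) x) (of_nat n *\<^sub>C x))"
    by (simp only: telescope sum_X[symmetric] A_inner_sum_right Re_sum)
  also have "\<dots> = real n * ((A_norm A x)\<^sup>2 - Re (a ^ n * A_inner A ((T ^^ n) x) x))"
    unfolding A_inner_simps A_inner_self by (simp add: algebra_simps)
  finally show ?thesis
    using \<open>n > 0\<close> by (simp add: zero_le_mult_iff)
qed

text \<open>The modulus of \<open>a\<close> is \<open>1 / c\<close>, as the bound on the real part
  requires, and its argument is chosen so that \<open>a ^ n\<close> rotates \<open>u\<close> onto
  the nonnegative real axis. There the real part is the modulus.\<close>

lemma numerical_power_le:
  fixes n :: nat
  assumes T: "bounded_clinear T" and "c > 0" "n > 0"
    and c: "\<And>y. cmod (A_inner A (T y) y) \<le> c * (A_norm A y)\<^sup>2"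
  shows "cmod (A_inner A ((T ^^ n) x) x) \<le> c ^ n * (A_norm A x)\<^sup>2"
proof -
  define u where "u = A_inner A ((T ^^ n) x) x"
  define a where "a = cis (- Arg u / n) / of_real c"
  have "cis (- Arg u / n) ^ n = cis (- Arg u)"
    using \<open>n > 0\<close> by (simp add: Complex.DeMoivre)
  moreover have "cis (- Arg u) * u = of_real (cmod u)"
    using rcis_cmod_Arg[of u] rcis_mult[of 1 "- Arg u" "cmod u" "Arg u"] by (simp add: rcis_def)
  ultimately have "a ^ n * u = of_real (cmod u / c ^ n)"
    by (simp add: a_def power_divide)
  moreover have "cmod a * cmod (A_inner A (T y) y) \<le> (A_norm A y)\<^sup>2" for y
    using c[of y] \<open>c > 0\<close> by (simp add: a_def norm_divide field_simps)
  ultimately have "cmod u / c ^ n \<le> (A_norm A x)\<^sup>2"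
    using numerical_power_Re_le[OF T \<open>n > 0\<close>, of a x] by (simp add: u_def)
  then show ?thesis
    using \<open>c > 0\<close> by (simp add: u_def field_simps)
qed

text \<open>The bound \<open>numerical_power_le\<close> divides by \<open>c\<close>, while
  \<open>w\<close> may be 0. It is applied to all \<open>c > w\<close>, and then \<open>c\<close>
  tends to \<open>w\<close> from the right.\<close>

lemma A_numerical_radius_power_le:
  fixes n :: nat
  assumes "A \<noteq> (\<lambda>x. 0)" "T \<in> A_bounded A" "n > 0"
  shows "A_numerical_radius A (T ^^ n) \<le> A_numerical_radius A T ^ n"
proof -
  define w where "w = A_numerical_radius A T"
  have T: "bounded_clinear T"
    using assms by (simp add: A_bounded_def)
  have w: "w \<ge> 0"
    unfolding w_def by (rule A_numerical_radius_nonneg[OF assms(1,2)])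
  have le: "A_numerical_radius A (T ^^ n) \<le> c ^ n" if "c > w" for c
  proof (rule A_numerical_radius_le[OF assms(1)])
    have "cmod (A_inner A (T y) y) \<le> c * (A_norm A y)\<^sup>2" for y
      using le_A_numerical_radius[OF assms(2), of y] mult_right_mono[of w c "(A_norm A y)\<^sup>2"] that
      by (simp add: w_def)
    then show "cmod (A_inner A ((T ^^ n) x) x) \<le> c ^ n * (A_norm A x)\<^sup>2" for x
      using that w by (intro numerical_power_le T assms) auto
  qed
  have "((\<lambda>c. c ^ n) \<longlongrightarrow> w ^ n) (at_right w)"
    by (intro tendsto_intros)
  then show ?thesis
    unfolding w_def[symmetric]
    by (rule tendsto_lowerbound) (auto simp: eventually_at_right_field intro!: le exI[of _ "w + 1"])
qed

section \<open>The spectral radius and its comparison with the numerical radius\<close>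

lemma A_spectral_radius_le:
  fixes n :: nat
  assumes "A \<noteq> (\<lambda>x. 0)" "T \<in> A_bounded A" "n > 0"
  shows "A_spectral_radius A T \<le> root n (A_opnorm A (T ^^ n))"
  unfolding A_spectral_radius_def using assms
  by (intro cINF_lower bdd_belowI2[of _ 0]) (auto intro!: A_opnorm_nonneg A_bounded_funpow)

lemma A_spectral_radius_nonneg:
  assumes "A \<noteq> (\<lambda>x. 0)" "T \<in> A_bounded A"
  shows "A_spectral_radius A T \<ge> 0"
  unfolding A_spectral_radius_def using assms
  by (intro cINF_greatest) (auto intro!: A_opnorm_nonneg A_bounded_funpow)

lemma A_spectral_radius_le_A_numerical_radius:
  assumes "A \<noteq> (\<lambda>x. 0)" "T \<in> A_bounded A"
  shows "A_spectral_radius A T \<le> A_numerical_radius A T"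
proof -
  define w where "w = A_numerical_radius A T"
  have w: "w \<ge> 0"
    unfolding w_def by (rule A_numerical_radius_nonneg[OF assms])
  have le: "A_spectral_radius A T \<le> root n 2 * w" if "n > 0" for n
  proof -
    have "A_opnorm A (T ^^ n) \<le> 2 * w ^ n"
      using A_opnorm_le_A_numerical_radius[OF assms(1) A_bounded_funpow[OF assms(2)], of n]
        A_numerical_radius_power_le[OF assms that] by (simp add: w_def)
    then have "root n (A_opnorm A (T ^^ n)) \<le> root n (2 * w ^ n)"
      using that by simp
    also have "\<dots> = root n 2 * w"
      using that w by (simp add: real_root_mult real_root_power_cancel)
    finally show ?thesis
      using A_spectral_radius_le[OF assms that] by linarith
  qed
  \<comment> \<open>The constant 2 disappears in the limit of \<open>n\<close>-th roots.\<close>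
  have "(\<lambda>n. root n 2 * w) \<longlonglongrightarrow> 1 * w"
    by (intro tendsto_intros LIMSEQ_root_const) simp
  then have "A_spectral_radius A T \<le> 1 * w"
    by (rule LIMSEQ_le_const) (auto intro!: exI[of _ 1] le)
  then show ?thesis
    by (simp add: w_def)
qed

text \<open>The infimum for \<open>T ^^ n\<close> runs over the powers of \<open>T\<close> with
  exponent \<open>n * m\<close>, a subset of those used for \<open>T\<close>; and the
  \<open>n\<close>-th power of a root of order \<open>n * m\<close> is the root of order
  \<open>m\<close>.\<close>

lemma A_spectral_radius_power_le:
  fixes n :: nat
  assumes "A \<noteq> (\<lambda>x. 0)" "T \<in> A_bounded A" "n > 0"
  shows "A_spectral_radius A T ^ n \<le> A_spectral_radius A (T ^^ n)"
  unfolding A_spectral_radius_def[of A "T ^^ n"]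
proof (rule cINF_greatest)
  fix m :: nat
  assume "m \<in> {1..}"
  then have "m > 0" by simp
  have "A_spectral_radius A T \<le> root (n * m) (A_opnorm A (T ^^ (n * m)))"
    using assms \<open>m > 0\<close> by (intro A_spectral_radius_le) auto
  then have "A_spectral_radius A T ^ n \<le> root (n * m) (A_opnorm A (T ^^ (n * m))) ^ n"
    by (intro power_mono A_spectral_radius_nonneg assms)
  also have "\<dots> = root m (A_opnorm A (T ^^ (n * m)))"
  proof -
    have "A_opnorm A (T ^^ (n * m)) \<ge> 0"
      by (intro A_opnorm_nonneg A_bounded_funpow assms)
    then show ?thesis
      using \<open>n > 0\<close> \<open>m > 0\<close> by (simp add: real_root_mult_exp)
  qed
  finally show "A_spectral_radius A T ^ n \<le> root m (A_opnorm A ((T ^^ n) ^^ m))"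
    by (simp add: funpow_mult)
qed simp

end

section \<open>The equivalence with multiplicativity of the numerical radius on powers\<close>

theorem theorem2p6:
  fixes A T :: "'a::chilbert_space \<Rightarrow> 'a"
  assumes "\<exists>x::'a. x \<noteq> 0"
    and "positive_op A"
    and "A \<noteq> (\<lambda>x. 0)"
    and "T \<in> A_bounded A"
  shows "A_spectraloid A T \<longleftrightarrow>
    (\<forall>n\<ge>1. A_numerical_radius A (T ^^ n) = A_numerical_radius A T ^ n)"
proof -
  interpret positive_operator A
    using assms(2) by unfold_locales
  note A = assms(3) and T = assms(4)
  show ?thesis
  proof
    assume "A_spectraloid A T"
    then have eq: "A_spectral_radius A T = A_numerical_radius A T"
      by (simp add: A_spectraloid_def)
    show "\<forall>n\<ge>1. A_numerical_radius A (T ^^ n) = A_numerical_radius A T ^ n"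
    proof (intro allI impI antisym)
      fix n :: nat
      assume "n \<ge> 1"
      then show "A_numerical_radius A (T ^^ n) \<le> A_numerical_radius A T ^ n"
        using A_numerical_radius_power_le[OF A T] by simp
      show "A_numerical_radius A T ^ n \<le> A_numerical_radius A (T ^^ n)"
        using A_spectral_radius_power_le[OF A T, of n] \<open>n \<ge> 1\<close>
          A_spectral_radius_le_A_numerical_radius[OF A A_bounded_funpow[OF T], of n]
        by (simp add: eq)
    qed
  next
    assume eq: "\<forall>n\<ge>1. A_numerical_radius A (T ^^ n) = A_numerical_radius A T ^ n"
    have "A_numerical_radius A T \<le> root n (A_opnorm A (T ^^ n))" if "n \<ge> 1" for n
    proof -
      have "A_numerical_radius A T ^ n \<le> A_opnorm A (T ^^ n)"
        using eq that A_numerical_radius_le_A_opnorm[OF A A_bounded_funpow[OF T], of n] by simp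
      then have "root n (A_numerical_radius A T ^ n) \<le> root n (A_opnorm A (T ^^ n))"
        using that by simp
      then show ?thesis
        using that A_numerical_radius_nonneg[OF A T] by (simp add: real_root_power_cancel)
    qed
    then have "A_numerical_radius A T \<le> A_spectral_radius A T"
      unfolding A_spectral_radius_def by (intro cINF_greatest) auto
    then show "A_spectraloid A T"
      using A_spectral_radius_le_A_numerical_radius[OF A T] T by (simp add: A_spectraloid_def)
  qed
qed

end
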